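(* Let $d\ge 2$, and let $0<r_1<r_2<\cdots<r_{d-1}$ and $0<t_1<t_2<\cdots<t_{d-1}$ be natural numbers. If $\alpha=(\alpha_n)_{n\in\mathbb{N}_0}$ is a Stieltjes moment sequence, then so is the sequence $$\left(\det \begin{bmatrix} \alpha_{n} & \alpha_{n+r_1} & \cdots & \alpha_{n+r_{d-1}} \\ \alpha_{n+t_1} & \alpha_{n+r_1+t_1} & \cdots & \alpha_{n+r_{d-1}+t_1} \\ \vdots & \vdots & \ddots & \vdots \\ \alpha_{n+t_{d-1}} & \alpha_{n+r_1+t_{d-1}} & \cdots & \alpha_{n+r_{d-1}+t_{d-1}} \end{bmatrix}\right)_{n\in\mathbb{N}_0}.$$
   Context: $\mathbb{N}_0$ denotes the set of nonnegative integers. A real sequence $\alpha=(\alpha_n)_{n\in\mathbb{N}_0}$ is a Stieltjes moment sequence if there is a nonnegative Borel measure $\mu$ on $\mathbb{R}$ with $\operatorname{supp}(\mu)\subset[0,\infty)$ such that $\alpha_n=\int_{[0,\infty)} x^n\,d\mu$ for all $n\in\mathbb{N}_0$ (all these integrals existing). *)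

theory Defs
  imports "HOL-Analysis.Analysis" "Jordan_Normal_Form.Determinant"
begin

definition measure_support :: "'a::topological_space measure \<Rightarrow> 'a set" where
  "measure_support M = {x. \<forall>U. open U \<longrightarrow> x \<in> U \<longrightarrow> emeasure M U > 0}"

(* Integrability is required explicitly, since the Bochner integral of a
   non-integrable function is 0 by convention. *)
definition stieltjes_moment_sequence :: "(nat \<Rightarrow> real) \<Rightarrow> bool" where
  "stieltjes_moment_sequence \<alpha> \<longleftrightarrow>
     (\<exists>\<mu> :: real measure. sets \<mu> = sets borel \<and> measure_support \<mu> \<subseteq> {0..} \<and>
        (\<forall>n. set_integrable \<mu> {0..} (\<lambda>x. x ^ n) \<and>
             \<alpha> n = set_lebesgue_integral \<mu> {0..} (\<lambda>x. x ^ n)))"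

end

theory Submission
  imports Defs
begin

text \<open>
  By Andreief's identity, the determinant is \<open>1 / d!\<close> times the integral over \<open>[0,\<infinity>)\<^sup>d\<close>, with respect
  to the product measure, of \<open>det (x\<^sub>k ^ t\<^sub>i) * det (x\<^sub>k ^ r\<^sub>j) * (x\<^sub>1 \<cdots> x\<^sub>d) ^ n\<close>. Both generalized
  Vandermonde determinants have the sign of the permutation that sorts the coordinates, so their
  product is a nonnegative density. Pushing this density forward along \<open>x \<mapsto> x\<^sub>1 \<cdots> x\<^sub>d\<close> gives a
  representing measure. The sign of a generalized Vandermonde determinant follows by induction on
  \<open>d\<close>: as a function of its last node it is a sparse polynomial with positive leading coefficient,
  and by Rolle's theorem it has no roots besides the other nodes.
\<close>

section \<open>Generalized Vandermonde determinants at increasing nodes\<close>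

definition gen_vandermonde :: "nat \<Rightarrow> (nat \<Rightarrow> nat) \<Rightarrow> (nat \<Rightarrow> real) \<Rightarrow> real" where
  "gen_vandermonde d e x = Determinant.det (Matrix.mat d d (\<lambda>(i, j). x i ^ e j))"

text \<open>Since \<open>e 0 = 0\<close>, the root \<open>0\<close> is admissible; the Rolle points are positive in any case, so
  the derivative can be divided by its lowest power of the variable.\<close>
lemma sparse_polynomial_zero:
  fixes e :: "nat \<Rightarrow> nat" and c x :: "nat \<Rightarrow> real"
  assumes "strict_mono_on {..<d} e" "e 0 = 0"
    and "strict_mono_on {..<d} x" "0 \<le> x 0"
    and "\<And>i. i < d \<Longrightarrow> (\<Sum>j<d. c j * x i ^ e j) = 0"
    and "j < d"
  shows "c j = 0"
  using assms
proof (induction d arbitrary: e c x j)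
  case 0
  then show ?case by simp
next
  case (Suc d)
  have e_less: "e i < e k" if "i < k" "k \<le> d" for i k
    using Suc.prems(1) that by (auto simp: strict_mono_on_def)
  have x_less: "x i < x k" if "i < k" "k \<le> d" for i k
    using Suc.prems(3) that by (auto simp: strict_mono_on_def)
  have x_nonneg: "0 \<le> x i" if "i \<le> d" for i
    using x_less[of 0 i] that Suc.prems(4) by (cases "i = 0") auto
  let ?f = "\<lambda>y. \<Sum>j<Suc d. c j * y ^ e j"
  let ?f' = "\<lambda>y. \<Sum>j<Suc d. c j * (real (e j) * y ^ (e j - 1))"
  have deriv: "(?f has_real_derivative ?f' y) (at y)" for y
    by (auto intro!: derivative_eq_intros sum.cong)
  have "\<exists>y. x i < y \<and> y < x (Suc i) \<and> ?f' y = 0" if "i < d" for i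
  proof -
    have "\<exists>y>x i. y < x (Suc i) \<and> (?f has_real_derivative 0) (at y)"
    proof (rule Rolle)
      show "x i < x (Suc i)" using x_less that by simp
      show "?f (x i) = ?f (x (Suc i))" using Suc.prems(5) that by simp
      show "continuous_on {x i..x (Suc i)} ?f" by (intro continuous_intros)
      show "?f differentiable (at y)" for y
        using deriv real_differentiable_def by blast
    qed
    then show ?thesis using deriv DERIV_unique by blast
  qed
  then obtain y where y: "x i < y i" "y i < x (Suc i)" "?f' (y i) = 0" if "i < d" for i
    by metis
  have x_le: "x i \<le> x k" if "i \<le> k" "k \<le> d" for i k
    using x_less[of i k] that by (cases "i = k") auto
  have y_pos: "0 < y i" if "i < d" for i
    using y(1)[OF that] x_nonneg[of i] that by simp
  have y_mono: "strict_mono_on {..<d} y"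
  proof (rule strict_mono_onI)
    fix i k assume "i \<in> {..<d}" "k \<in> {..<d}" "i < k"
    then show "y i < y k"
      using y(2)[of i] y(1)[of k] x_le[of "Suc i" k] by auto
  qed
  \<comment> \<open>Since \<open>e 0 = 0\<close>, differentiation kills the constant term. The
    quotient of \<open>?f'\<close> by \<open>y ^ (e 1 - 1)\<close> has \<open>d\<close> terms,
    exponents starting at 0 and the \<open>d\<close> roots \<open>y i\<close>, so the induction
    hypothesis applies.\<close>
  have tail: "c (Suc j) = 0" if j: "j < d" for j
  proof -
    have "c (Suc j) * real (e (Suc j)) = 0"
    proof (rule Suc.IH[of "\<lambda>j. e (Suc j) - e 1" y "\<lambda>j. c (Suc j) * real (e (Suc j))"])
      show "strict_mono_on {..<d} (\<lambda>j. e (Suc j) - e 1)"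
      proof (rule strict_mono_onI)
        fix i k assume "i \<in> {..<d}" "k \<in> {..<d}" "i < k"
        then show "e (Suc i) - e 1 < e (Suc k) - e 1"
          using e_less[of "Suc i" "Suc k"] e_less[of 1 "Suc i"]
          by (cases i) auto
      qed
      show "0 \<le> y 0" using y_pos[of 0] j by simp
      show "(\<Sum>j<d. c (Suc j) * real (e (Suc j)) * y i ^ (e (Suc j) - e 1)) = 0" if "i < d" for i
      proof -
        have e1: "0 < e 1" using e_less[of 0 1] j by simp
        have "e 1 \<le> e (Suc k)" if "k < d" for k
          using e_less[of 1 "Suc k"] that by (cases k) auto
        then have "c (Suc k) * (real (e (Suc k)) * y i ^ (e (Suc k) - 1))
            = y i ^ (e 1 - 1) * (c (Suc k) * real (e (Suc k)) * y i ^ (e (Suc k) - e 1))"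
          if "k < d" for k
          using e1 that by (simp flip: power_add)
        then have "?f' (y i)
            = y i ^ (e 1 - 1) * (\<Sum>j<d. c (Suc j) * real (e (Suc j)) * y i ^ (e (Suc j) - e 1))"
          unfolding sum.lessThan_Suc_shift
          using Suc.prems(2) by (auto simp: sum_distrib_left simp del: mult_eq_0_iff intro!: sum.cong)
        then show ?thesis using y(3)[OF that] y_pos[OF that] by simp
      qed
    qed (use j y_mono in auto)
    then show ?thesis using e_less[of 0 "Suc j"] j by simp
  qed
  \<comment> \<open>Only the constant term is left, and \<open>x 0 ^ 0 = 1\<close> even if
    \<open>x 0 = 0\<close>.\<close>
  have "c 0 = 0"
    using Suc.prems(5)[of 0] tail Suc.prems(2) by (simp add: sum.lessThan_Suc_shift del: sum.lessThan_Suc)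
  with tail Suc.prems(6) show ?case by (cases j) auto
qed

text \<open>The exponents below the top one are at most \<open>e d - 1\<close>, so the leading term
  wins as soon as \<open>c d * z\<close> exceeds the sum of the other absolute coefficients.\<close>

lemma sparse_polynomial_pos_at_top:
  fixes e :: "nat \<Rightarrow> nat" and c :: "nat \<Rightarrow> real"
  assumes e: "strict_mono_on {..d} e" and c: "0 < c d"
  shows "\<exists>z>y. 0 < (\<Sum>j\<le>d. c j * z ^ e j)"
proof -
  define C where "C = (\<Sum>j<d. \<bar>c j\<bar>)"
  define z where "z = Max {1, y, C / c d} + 1"
  have z: "1 \<le> z" "y < z" "C / c d < z"
    unfolding z_def by auto
  have Cz: "C < c d * z" using z(3) c by (simp add: field_simps)
  have bound: "- (\<bar>c j\<bar> * z ^ (e d - 1)) \<le> c j * z ^ e j" if "j < d" for j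
  proof -
    have "e j < e d" using e that by (auto simp: strict_mono_on_def)
    then have "z ^ e j \<le> z ^ (e d - 1)" using z(1) by (intro power_increasing) auto
    then have "\<bar>c j * z ^ e j\<bar> \<le> \<bar>c j\<bar> * z ^ (e d - 1)"
      using z(1) by (simp add: abs_mult mult_left_mono)
    then show ?thesis by linarith
  qed
  have lower: "- (C * z ^ (e d - 1)) \<le> (\<Sum>j<d. c j * z ^ e j)"
    unfolding C_def sum_distrib_right sum_negf[symmetric] using bound by (intro sum_mono) auto
  \<comment> \<open>For \<open>d = 0\<close> the exponent \<open>e d\<close> may be 0 and
    \<open>e d - 1\<close> truncates, but then \<open>C = 0\<close>.\<close>
  have "C * z ^ (e d - 1) < c d * z ^ e d"
  proof (cases "d = 0")
    case True
    then show ?thesis using c z(1) by (simp add: C_def)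
  next
    case False
    then have "e 0 < e d" using e by (auto simp: strict_mono_on_def)
    then have "z ^ e d = z * z ^ (e d - 1)" by (simp add: power_eq_if)
    then show ?thesis using Cz z(1) by simp
  qed
  with lower have "0 < (\<Sum>j<Suc d. c j * z ^ e j)" by simp
  then show ?thesis using z(2) unfolding lessThan_Suc_atMost by blast
qed

lemma gen_vandermonde_pos:
  assumes "strict_mono_on {..<d} e" "e 0 = 0"
    and "strict_mono_on {..<d} x" "0 \<le> x 0"
  shows "0 < gen_vandermonde d e x"
  using assms
proof (induction d)
  case 0
  then show ?case by (simp add: gen_vandermonde_def)
next
  case (Suc d)
  define A where "A = Matrix.mat (Suc d) (Suc d) (\<lambda>(i, j). x i ^ e j)"
  define c where "c j = cofactor A d j" for j
  \<comment> \<open>Laplace expansion along the last row: its cofactors do not involve the last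
    node, so they are constants in \<open>y\<close>.\<close>
  have expand: "gen_vandermonde (Suc d) e (x(d := y)) = (\<Sum>j<Suc d. c j * y ^ e j)" for y
  proof -
    let ?B = "Matrix.mat (Suc d) (Suc d) (\<lambda>(i, j). (x(d := y)) i ^ e j)"
    have "cofactor ?B d j = c j" if "j < Suc d" for j
      unfolding c_def cofactor_def
      by (intro arg_cong2[of _ _ _ _ "(*)"] refl arg_cong[of _ _ Determinant.det] eq_matI)
        (auto simp: mat_delete_def A_def)
    moreover have "?B $$ (d, j) = y ^ e j" if "j < Suc d" for j
      using that by simp
    ultimately have "Determinant.det ?B = (\<Sum>j<Suc d. y ^ e j * c j)"
      by (subst laplace_expansion_row[where i = d and n = "Suc d"]) (auto intro!: sum.cong)
    then show ?thesis by (simp add: gen_vandermonde_def mult.commute)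
  qed
  have sub: "strict_mono_on {..<d} e" "strict_mono_on {..<d} x"
    using Suc.prems by (auto simp: strict_mono_on_def)
  have "c d = gen_vandermonde d e x"
    unfolding c_def cofactor_def gen_vandermonde_def A_def
    by (auto intro!: arg_cong[of _ _ Determinant.det] eq_matI simp: mat_delete_def)
  then have c_pos: "0 < c d" using Suc.IH Suc.prems sub by simp
  let ?f = "\<lambda>y. \<Sum>j<Suc d. c j * y ^ e j"
  \<comment> \<open>Repeating an earlier node makes two rows equal.\<close>
  have roots: "?f (x i) = 0" if "i < d" for i
  proof -
    let ?B = "Matrix.mat (Suc d) (Suc d) (\<lambda>(k, j). (x(d := x i)) k ^ e j)"
    have "Determinant.det ?B = 0"
      using that by (intro det_identical_rows[of _ "Suc d" i d]) (auto simp: Matrix.row_def)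
    then show ?thesis using expand[of "x i"] by (simp add: gen_vandermonde_def)
  qed
  have "0 < ?f (x d)"
  \<comment> \<open>Otherwise the intermediate value theorem gives a root \<open>w\<close> at or
    beyond \<open>x d\<close>. Together with the \<open>d\<close> earlier nodes this makes
    \<open>d + 1\<close> roots for \<open>d + 1\<close> terms, which forces
    \<open>c d = 0\<close>.\<close>
  proof (rule ccontr)
    assume neg: "\<not> 0 < ?f (x d)"
    obtain z where z: "z > x d" "0 < ?f z"
      using sparse_polynomial_pos_at_top[of d e c "x d"] Suc.prems(1) c_pos
      unfolding lessThan_Suc_atMost by blast
    have "\<exists>w\<ge>x d. w \<le> z \<and> ?f w = 0"
      using neg z by (intro IVT') (auto intro!: continuous_intros)
    then obtain w where w: "x d \<le> w" "?f w = 0" by blast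
    have "c d = 0"
    proof (rule sparse_polynomial_zero[of "Suc d" e "x(d := w)" c])
      show "strict_mono_on {..<Suc d} (x(d := w))"
      proof (rule strict_mono_onI)
        fix i k assume "i \<in> {..<Suc d}" "k \<in> {..<Suc d}" "i < k"
        moreover from this have "x i < x k" using Suc.prems(3) by (auto simp: strict_mono_on_def)
        ultimately show "(x(d := w)) i < (x(d := w)) k" using w(1) by auto
      qed
      show "0 \<le> (x(d := w)) 0" using Suc.prems(4) w(1) by auto
      show "(\<Sum>j<Suc d. c j * (x(d := w)) i ^ e j) = 0" if "i < Suc d" for i
        using that roots[of i] w(2) by (cases "i = d") auto
    qed (use Suc.prems in auto)
    with c_pos show False by simp
  qed
  then show ?case using expand[of "x d"] by simp
qed

section \<open>Arbitrary nonnegative nodes\<close>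

lemma gen_vandermonde_permute:
  assumes "p permutes {0..<d}"
  shows "gen_vandermonde d e (x \<circ> p) = of_int (sign p) * gen_vandermonde d e x"
proof -
  let ?A = "Matrix.mat d d (\<lambda>(i, j). x i ^ e j)"
  have "p i < d" if "i < d" for i
    using permutes_in_image[OF assms, of i] that by simp
  then have "Matrix.mat d d (\<lambda>(i, j). (x \<circ> p) i ^ e j) = Matrix.mat d d (\<lambda>(i, j). ?A $$ (p i, j))"
    by (intro eq_matI) auto
  then show ?thesis
    unfolding gen_vandermonde_def using det_permute_rows[OF _ assms, of ?A] by simp
qed

lemma gen_vandermonde_not_inj:
  assumes "\<not> inj_on x {..<d}"
  shows "gen_vandermonde d e x = 0"
proof -
  from assms obtain i k where ik: "i < d" "k < d" "i \<noteq> k" "x i = x k"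
    by (auto simp: inj_on_def)
  then show ?thesis unfolding gen_vandermonde_def
    by (intro det_identical_rows[of _ d i k]) (auto simp: Matrix.row_def)
qed

text \<open>The permutation comes from sorting the list of values; injectivity makes the sorted list
  strictly increasing.\<close>

lemma ex_permutes_strict_mono:
  fixes x :: "nat \<Rightarrow> 'a::linorder"
  assumes "inj_on x {..<d}"
  obtains p where "p permutes {0..<d}" "strict_mono_on {..<d} (x \<circ> p)"
proof -
  define xs where "xs = map x [0..<d]"
  have "mset (sort xs) = mset xs" by simp
  then obtain p where p: "p permutes {..<length xs}" "permute_list p xs = sort xs"
    by (rule mset_eq_permutation)
  have len: "length xs = d" by (simp add: xs_def)
  have p_less: "p i < d" if "i < d" for i
    using permutes_in_image[OF p(1), of i] that len by simp
  have nth: "(x \<circ> p) i = sort xs ! i" if "i < d" for i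
    using permute_list_nth[OF p(1), of i] that p_less[OF that] len p(2) by (simp add: xs_def)
  have "distinct (sort xs)"
    using assms by (simp add: xs_def distinct_map atLeast0LessThan)
  then have "sorted_wrt (<) (sort xs)" by (simp add: strict_sorted_iff)
  then have "strict_mono_on {..<d} (x \<circ> p)"
    using nth len by (auto intro!: strict_mono_onI simp: sorted_wrt_iff_nth_less simp del: o_apply)
  with p(1) len that show thesis by (simp add: atLeast0LessThan)
qed

text \<open>Sorting distinct nodes makes both factors positive and multiplies each by the same sign,
  which cancels in the product.\<close>

lemma gen_vandermonde_mult_nonneg:
  assumes r: "strict_mono_on {..<d} r" "r 0 = 0"
    and t: "strict_mono_on {..<d} t" "t 0 = 0"
    and x: "\<And>i. i < d \<Longrightarrow> 0 \<le> x i"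
  shows "0 \<le> gen_vandermonde d t x * gen_vandermonde d r x"
proof (cases "inj_on x {..<d} \<and> d \<noteq> 0")
  case True
  then obtain p where p: "p permutes {0..<d}" "strict_mono_on {..<d} (x \<circ> p)"
    using ex_permutes_strict_mono by blast
  have "p 0 < d" using permutes_in_image[OF p(1), of 0] True by simp
  then have "0 \<le> (x \<circ> p) 0" using x by simp
  then have "0 < gen_vandermonde d t (x \<circ> p) * gen_vandermonde d r (x \<circ> p)"
    using gen_vandermonde_pos r t p(2) by simp
  also have "\<dots> = of_int (sign p * sign p) * (gen_vandermonde d t x * gen_vandermonde d r x)"
    by (simp only: gen_vandermonde_permute[OF p(1)] of_int_mult ac_simps)
  also have "\<dots> = gen_vandermonde d t x * gen_vandermonde d r x"
    by simp
  finally show ?thesis by simp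
next
  \<comment> \<open>Either a node repeats and both determinants vanish, or \<open>d = 0\<close> and
    both equal 1.\<close>
  case False
  then show ?thesis
    using gen_vandermonde_not_inj[of x d] by (auto simp: gen_vandermonde_def)
qed

section \<open>Leibniz expansion and Andreief's identity\<close>

lemma det_mat_leibniz:
  "Determinant.det (Matrix.mat d d (\<lambda>(i, j). F i j))
    = (\<Sum>p | p permutes {..<d}. of_int (sign p) * (\<Prod>k<d. F k (p k)))"
proof -
  have "p k < d" if "p permutes {..<d}" "k < d" for p :: "nat \<Rightarrow> nat" and k
    using permutes_in_image[of p "{..<d}" k] that by simp
  then show ?thesis
    unfolding det_def'[OF mat_carrier] atLeast0LessThan
    by (auto intro!: sum.cong prod.cong)
qed

text \<open>Row \<open>k\<close> has the common factor \<open>x k ^ n\<close>. This turns the index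
  shift \<open>n\<close> into the \<open>n\<close>-th power of one variable, the product of the
  nodes.\<close>

lemma gen_vandermonde_shift:
  "gen_vandermonde d (\<lambda>j. n + e j) x = (\<Prod>k<d. x k) ^ n * gen_vandermonde d e x"
  unfolding gen_vandermonde_def
  by (simp add: det_mat_leibniz power_add prod.distrib prod_power_distrib sum_distrib_left mult.left_commute)

text \<open>Both determinants are expanded over permutations \<open>p\<close> and \<open>q\<close>;
  each term is a product of functions of one coordinate, so its integral factors.\<close>

lemma has_bochner_integral_andreief:
  fixes N :: "'a measure" and f g :: "nat \<Rightarrow> 'a \<Rightarrow> real"
  assumes "sigma_finite_measure N"
    and int: "\<And>i j. i < d \<Longrightarrow> j < d \<Longrightarrow> integrable N (\<lambda>x. f i x * g j x)"
  shows "has_bochner_integral (Pi\<^sub>M {..<d} (\<lambda>_. N))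
    (\<lambda>x. Determinant.det (Matrix.mat d d (\<lambda>(k, i). f i (x k))) *
         Determinant.det (Matrix.mat d d (\<lambda>(k, j). g j (x k))))
    (fact d * Determinant.det (Matrix.mat d d (\<lambda>(i, j). \<integral>x. f i x * g j x \<partial>N)))"
    (is "has_bochner_integral ?P ?F (_ * Determinant.det ?A)")
proof -
  interpret product_sigma_finite "\<lambda>_::nat. N"
    using assms(1) by (simp add: product_sigma_finite_def)
  let ?S = "{p. p permutes {0..<d}}"
  have less: "p k < d" if "p \<in> ?S" "k < d" for p :: "nat \<Rightarrow> nat" and k
    using permutes_in_image[of p "{0..<d}" k] that by simp
  have F: "?F x = (\<Sum>p\<in>?S. \<Sum>q\<in>?S. (of_int (sign p) * of_int (sign q)) *
      (\<Prod>k<d. f (p k) (x k) * g (q k) (x k)))" for x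
    by (simp add: det_mat_leibniz sum_product prod.distrib mult_ac atLeast0LessThan)
  have summand: "has_bochner_integral ?P (\<lambda>x. \<Prod>k<d. f (p k) (x k) * g (q k) (x k))
      (\<Prod>k<d. \<integral>x. f (p k) x * g (q k) x \<partial>N)" if "p \<in> ?S" "q \<in> ?S" for p q
    using product_integrable_prod[of "{..<d}" "\<lambda>k x. f (p k) x * g (q k) x"]
      product_integral_prod[of "{..<d}" "\<lambda>k x. f (p k) x * g (q k) x"] int less that
    by (simp add: has_bochner_integral_iff)
  \<comment> \<open>For fixed \<open>p\<close>, the sum over \<open>q\<close> is the determinant of
    \<open>?A\<close> with rows permuted by \<open>p\<close>. The two factors \<open>sign p\<close>
    cancel, so each of the \<open>d!\<close> permutations contributes the determinant of
    \<open>?A\<close>.\<close>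
  have "(\<Sum>p\<in>?S. \<Sum>q\<in>?S. (of_int (sign p) * of_int (sign q)) * (\<Prod>k<d. \<integral>x. f (p k) x * g (q k) x \<partial>N))
      = (\<Sum>p\<in>?S. of_int (sign p) * (of_int (sign p) * Determinant.det ?A))"
  proof (rule sum.cong[OF refl])
    fix p assume p: "p \<in> ?S"
    have "Matrix.mat d d (\<lambda>(i, j). ?A $$ (p i, j))
        = Matrix.mat d d (\<lambda>(i, j). \<integral>x. f (p i) x * g j x \<partial>N)"
      using less p by (intro eq_matI) auto
    then have "(\<Sum>q\<in>?S. (of_int (sign p) * of_int (sign q)) *
          (\<Prod>k<d. \<integral>x. f (p k) x * g (q k) x \<partial>N))
        = of_int (sign p) * Determinant.det (Matrix.mat d d (\<lambda>(i, j). ?A $$ (p i, j)))"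
      by (simp add: det_mat_leibniz sum_distrib_left mult.assoc atLeast0LessThan)
    then show "(\<Sum>q\<in>?S. (of_int (sign p) * of_int (sign q)) *
          (\<Prod>k<d. \<integral>x. f (p k) x * g (q k) x \<partial>N))
        = of_int (sign p) * (of_int (sign p) * Determinant.det ?A)"
      using det_permute_rows[of ?A d p] p by simp
  qed
  also have "\<dots> = fact d * Determinant.det ?A"
    by (simp add: mult.assoc[symmetric] card_permutations flip: of_int_mult)
  finally have sum_eq: "fact d * Determinant.det ?A =
      (\<Sum>p\<in>?S. \<Sum>q\<in>?S. (of_int (sign p) * of_int (sign q)) *
        (\<Prod>k<d. \<integral>x. f (p k) x * g (q k) x \<partial>N))"
    by simp
  show ?thesis
    unfolding F sum_eq
    by (intro has_bochner_integral_sum has_bochner_integral_mult_right summand)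
qed

section \<open>Construction of the representing measure\<close>

theorem theorem2p11:
  fixes d :: nat and r t :: "nat \<Rightarrow> nat" and \<alpha> :: "nat \<Rightarrow> real"
  assumes "d \<ge> 2"
    and "r 0 = 0" and "strict_mono_on {0..<d} r"
    and "t 0 = 0" and "strict_mono_on {0..<d} t"
    and "stieltjes_moment_sequence \<alpha>"
  shows "stieltjes_moment_sequence
    (\<lambda>n. Determinant.det (Matrix.mat d d (\<lambda>(i, j). \<alpha> (n + r j + t i))))"
proof -
  from assms(6) obtain \<mu> :: "real measure" where \<mu>: "sets \<mu> = sets borel"
    and \<mu>_int: "\<And>n. set_integrable \<mu> {0..} (\<lambda>x. x ^ n)"
    and \<alpha>: "\<And>n. \<alpha> n = set_lebesgue_integral \<mu> {0..} (\<lambda>x. x ^ n)"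
    unfolding stieltjes_moment_sequence_def by blast
  have space_\<mu>: "space \<mu> = UNIV" using sets_eq_imp_space_eq[OF \<mu>] by simp
  \<comment> \<open>After restriction, every point of the product space has nonnegative coordinates,
    not just almost every one.\<close>
  define N where "N = restrict_space \<mu> {0..}"
  have [measurable]: "{0..} \<in> sets \<mu>" using \<mu> by simp
  have N_int: "integrable N (\<lambda>x. x ^ n)" for n
    using \<mu>_int[of n] space_\<mu> \<mu> by (simp add: N_def integrable_restrict_space set_integrable_def)
  have N_integral: "\<alpha> n = (\<integral>x. x ^ n \<partial>N)" for n
    using space_\<mu> \<mu> by (simp add: N_def integral_restrict_space \<alpha> set_lebesgue_integral_def)
  have space_N: "space N = {0..}" by (simp add: N_def space_restrict_space space_\<mu>)
  \<comment> \<open>The zeroth moment bounds the total mass, which gives the sigma-finiteness needed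
    for products.\<close>
  have "integrable N (\<lambda>_. 1 :: real)" using N_int[of 0] by simp
  then have "emeasure N (space N) \<noteq> \<infinity>"
    by (simp add: integrable_iff_bounded less_top)
  then interpret N: finite_measure N by (rule finite_measureI)
  define P where "P = Pi\<^sub>M {..<d} (\<lambda>_. N)"
  have P_nonneg: "0 \<le> x k" if "x \<in> space P" "k < d" for x k
    using that space_N by (auto simp: P_def space_PiM)
  define h where "h x = gen_vandermonde d t x * gen_vandermonde d r x / fact d" for x
  define m where "m x = (\<Prod>k<d. x k)" for x :: "nat \<Rightarrow> real"
  have h_nonneg: "0 \<le> h x" if "x \<in> space P" for x
    unfolding h_def using assms P_nonneg[OF that]
    by (intro divide_nonneg_pos gen_vandermonde_mult_nonneg) (auto simp: atLeast0LessThan)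
  have m_nonneg: "0 \<le> m x" if "x \<in> space P" for x
    unfolding m_def using P_nonneg[OF that] by (intro prod_nonneg) auto
  have moments: "has_bochner_integral P (\<lambda>x. h x * m x ^ n)
      (Determinant.det (Matrix.mat d d (\<lambda>(i, j). \<alpha> (n + r j + t i))))" for n
  proof -
    \<comment> \<open>The shift \<open>n\<close> is put on the exponents \<open>t\<close> alone, so
      that the entries integrate to \<open>\<alpha> (n + r j + t i)\<close> and
      \<open>m x ^ n\<close> can be pulled out of a single determinant.\<close>
    have "has_bochner_integral P
        (\<lambda>x. gen_vandermonde d (\<lambda>i. n + t i) x * gen_vandermonde d r x)
        (fact d * Determinant.det (Matrix.mat d d (\<lambda>(i, j). \<integral>x. x ^ (n + t i) * x ^ r j \<partial>N)))"
      unfolding P_def gen_vandermonde_def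
      by (rule has_bochner_integral_andreief[of N d "\<lambda>i x. x ^ (n + t i)" "\<lambda>j x. x ^ r j"])
        (simp_all add: N.sigma_finite_measure_axioms N_int flip: power_add)
    then have "has_bochner_integral P
        (\<lambda>x. gen_vandermonde d (\<lambda>i. n + t i) x * gen_vandermonde d r x / fact d)
        (Determinant.det (Matrix.mat d d (\<lambda>(i, j). \<integral>x. x ^ (n + t i) * x ^ r j \<partial>N)))"
      using has_bochner_integral_divide_zero[where c = "fact d"] by fastforce
    then show ?thesis
      by (simp add: gen_vandermonde_shift h_def m_def N_integral add_ac mult_ac flip: power_add)
  qed
  have [measurable]: "h \<in> borel_measurable P"
    using moments[of 0] by (auto simp: has_bochner_integral_iff intro: borel_measurable_integrable)
  have [measurable]: "(\<lambda>x. x) \<in> borel_measurable N"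
    using N_int[of 1] by simp
  have [measurable]: "m \<in> borel_measurable P"
    unfolding m_def P_def by measurable
  define \<nu> where "\<nu> = distr (density P h) borel m"
  have ind: "indicat_real {0..} (m x) = 1" if "x \<in> space P" for x
    using m_nonneg[OF that] by simp
  \<comment> \<open>\<open>density\<close> sees \<open>h\<close> through \<open>ennreal\<close>,
    which sends negative values to 0; nonnegativity ensures that nothing is lost.\<close>
  have h_AE: "AE x in P. 0 \<le> h x" using h_nonneg by (auto intro: AE_I2)
  have "measure_support \<nu> \<subseteq> {0..}"
  proof
    fix y assume y: "y \<in> measure_support \<nu>"
    \<comment> \<open>The open half-line \<open>{..<0}\<close> is a null set for
      \<open>\<nu>\<close> and a neighbourhood of each negative point, so no such point lies in the
      support.\<close>
    have "m -` {..<0} \<inter> space P = {}" using m_nonneg by force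
    then have "emeasure \<nu> {..<0} = 0"
      by (simp add: \<nu>_def emeasure_distr)
    then show "y \<in> {0..}"
      using y unfolding measure_support_def by (force dest: spec[of _ "{..<0}"])
  qed
  moreover have "set_integrable \<nu> {0..} (\<lambda>y. y ^ n)" for n
  proof -
    have "integrable P (\<lambda>x. h x *\<^sub>R (indicat_real {0..} (m x) *\<^sub>R m x ^ n))"
      using moments[of n] ind by (simp add: has_bochner_integral_iff cong: Bochner_Integration.integrable_cong)
    then show ?thesis
      unfolding set_integrable_def \<nu>_def
      by (simp add: integrable_distr_eq integrable_density h_AE)
  qed
  moreover have "Determinant.det (Matrix.mat d d (\<lambda>(i, j). \<alpha> (n + r j + t i)))
      = set_lebesgue_integral \<nu> {0..} (\<lambda>y. y ^ n)" for n
  proof -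
    have "set_lebesgue_integral \<nu> {0..} (\<lambda>y. y ^ n)
        = (\<integral>x. h x *\<^sub>R (indicat_real {0..} (m x) *\<^sub>R m x ^ n) \<partial>P)"
      unfolding set_lebesgue_integral_def \<nu>_def
      by (simp add: integral_distr integral_density h_AE)
    also have "\<dots> = (\<integral>x. h x * m x ^ n \<partial>P)"
      using ind by (intro Bochner_Integration.integral_cong) auto
    finally show ?thesis using moments[of n] by (simp add: has_bochner_integral_iff)
  qed
  moreover have "sets \<nu> = sets borel" by (simp add: \<nu>_def)
  ultimately show ?thesis
    unfolding stieltjes_moment_sequence_def by blast
qed

end
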